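(* Consider the reference triangle with vertices $(0,0),(1,0),(0,1)$, with one node on each edge, $P_s=(s,0)$, $P_r=(1-r,r)$, $P_q=(0,q)$, where $r,q,s\in(0,1)$. Suppose the triangle is cut by an interface either in interior points of two different edges, or in one vertex and an interior point of the opposite edge. Let it be divided into four subtriangles according to the configuration (A, B, C or D, see context) belonging to the type of cut, where the parameters of the cut edges are determined by the cut (and arbitrary in $(0,1)$) and the remaining free parameters are chosen by the rules given in the context. Then all interior angles of all the subtriangles that can occur are bounded by $162^\circ$, independently of $r,q,s\in(0,1)$.
   Context: Configurations (division into four subtriangles): - Configuration A (cut through interior points of two edges): draw the segments $P_sP_r$, $P_rP_q$, $P_qP_s$. - Configuration B (cut through vertex $(0,0)$ and the opposite edge at $P_r$): draw $(0,0)P_r$, $P_qP_r$, $P_sP_r$. - Configuration C (cut through vertex $(1,0)$ and the opposite edge at $P_q$): draw $(1,0)P_q$, $P_sP_q$, $P_rP_q$. - Configuration D (cut through vertex $(0,1)$ and the opposite edge at $P_s$): draw $(0,1)P_s$, $P_qP_s$, $P_rP_s$. The parameter of an edge cut in its interior is determined by the cut. Rules for the free parameters: - Two edges cut (one free parameter): - if $q,s$ are determined by the cut and $q>\tfrac12$, $s>\tfrac12$, then $r$ is set to any one of $1-s$, $q$, $(1-s)(1-q)$; - if $s,r$ are determined by the cut and $s<\tfrac12$, $r>\tfrac12$, then $q$ is set to any one of $s$, $r$, $(1-r)s$; - if $q,r$ are determined by the cut and $q<\tfrac12$, $r<\tfrac12$, then $s$ is set to any one of $1-r$, $q$, $qr$;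 - in all remaining cases in which two edges are cut, the free parameter is set to $\tfrac12$. - A vertex and the opposite edge cut (two free parameters): - if $r$ is determined by the cut (configuration B): $s=1-r$ if $r<\tfrac12$ and $s=\tfrac12$ otherwise; $q=r$ if $r>\tfrac12$ and $q=\tfrac12$ otherwise; - if $q$ is determined by the cut (configuration C): $s=q$ if $q<\tfrac12$ and $s=\tfrac12$ otherwise; $r=q$ if $q>\tfrac12$ and $r=\tfrac12$ otherwise; - if $s$ is determined by the cut (configuration D): $r=1-s$ if $s>\tfrac12$ and $r=\tfrac12$ otherwise; $q=s$ if $s<\tfrac12$ and $q=\tfrac12$ otherwise. *)

theory Defs
  imports "HOL-Analysis.Analysis"
begin

type_synonym point = "real \<times> real"
type_synonym triangle = "point \<times> point \<times> point"  \<comment> \<open>the three vertices\<close>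

definition node_s :: "real \<Rightarrow> point" where
  "node_s s = (s, 0)"

definition node_r :: "real \<Rightarrow> point" where
  "node_r r = (1 - r, r)"

definition node_q :: "real \<Rightarrow> point" where
  "node_q q = (0, q)"

text \<open>
  The edges of the reference triangle are named after the parameter of their node: edge s joins
  (0,0) and (1,0), edge r joins (1,0) and (0,1), edge q joins (0,0) and (0,1). In the first three
  cases the interface cuts the two named edges in interior points; in the last three it passes
  through the named vertex and an interior point of the opposite edge. The interior intersection
  points are the nodes of the cut edges.
\<close>

datatype cut =
    Edges_QS | Edges_SR | Edges_QR
  | Vertex_00_Edge_R | Vertex_10_Edge_Q | Vertex_01_Edge_S

text \<open>
  The rules relating the free parameters to those determined by the cut. The latter are
  unconstrained here, except that all parameters lie in the open unit interval. The rules for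
  two cut edges may allow several choices, so this is a relation.
\<close>

fun chosen_by_rules :: "cut \<Rightarrow> real \<Rightarrow> real \<Rightarrow> real \<Rightarrow> bool" where
  "chosen_by_rules Edges_QS r q s \<longleftrightarrow>
     (if q > 1/2 \<and> s > 1/2 then r \<in> {1 - s, q, (1 - s) * (1 - q)} else r = 1/2)"
| "chosen_by_rules Edges_SR r q s \<longleftrightarrow>
     (if s < 1/2 \<and> r > 1/2 then q \<in> {s, r, (1 - r) * s} else q = 1/2)"
| "chosen_by_rules Edges_QR r q s \<longleftrightarrow>
     (if q < 1/2 \<and> r < 1/2 then s \<in> {1 - r, q, q * r} else s = 1/2)"
| "chosen_by_rules Vertex_00_Edge_R r q s \<longleftrightarrow>
     s = (if r < 1/2 then 1 - r else 1/2) \<and> q = (if r > 1/2 then r else 1/2)"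
| "chosen_by_rules Vertex_10_Edge_Q r q s \<longleftrightarrow>
     s = (if q < 1/2 then q else 1/2) \<and> r = (if q > 1/2 then q else 1/2)"
| "chosen_by_rules Vertex_01_Edge_S r q s \<longleftrightarrow>
     r = (if s > 1/2 then 1 - s else 1/2) \<and> q = (if s < 1/2 then s else 1/2)"

datatype configuration = Config_A | Config_B | Config_C | Config_D

fun configuration_of :: "cut \<Rightarrow> configuration" where
  "configuration_of Edges_QS = Config_A"
| "configuration_of Edges_SR = Config_A"
| "configuration_of Edges_QR = Config_A"
| "configuration_of Vertex_00_Edge_R = Config_B"
| "configuration_of Vertex_10_Edge_Q = Config_C"
| "configuration_of Vertex_01_Edge_S = Config_D"

text \<open>
  The four triangles into which the reference triangle is divided by three drawn segments. Writing
  S, R, Q for the three nodes, the segments are SR, RQ, QS in configuration A; (0,0)R, QR, SR in B;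
  (1,0)Q, SQ, RQ in C; and (0,1)S, QS, RS in D.
\<close>

fun subtriangles :: "configuration \<Rightarrow> real \<Rightarrow> real \<Rightarrow> real \<Rightarrow> triangle set" where
  "subtriangles Config_A r q s =
     {((0,0), node_s s, node_q q),
      (node_s s, (1,0), node_r r),
      (node_q q, node_r r, (0,1)),
      (node_s s, node_r r, node_q q)}"
| "subtriangles Config_B r q s =
     {((0,0), node_s s, node_r r),
      (node_s s, (1,0), node_r r),
      ((0,0), node_r r, node_q q),
      (node_q q, node_r r, (0,1))}"
| "subtriangles Config_C r q s =
     {((0,0), node_s s, node_q q),
      (node_s s, (1,0), node_q q),
      ((1,0), node_r r, node_q q),
      (node_q q, node_r r, (0,1))}"
| "subtriangles Config_D r q s =
     {((0,0), node_s s, node_q q),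
      (node_q q, node_s s, (0,1)),
      (node_s s, node_r r, (0,1)),
      (node_s s, (1,0), node_r r)}"

text \<open>The unoriented angle at the vertex B, in radians.\<close>

definition angle :: "point \<Rightarrow> point \<Rightarrow> point \<Rightarrow> real" where
  "angle A B C = arccos (((A - B) \<bullet> (C - B)) / (norm (A - B) * norm (C - B)))"

fun interior_angles :: "triangle \<Rightarrow> real set" where
  "interior_angles (A, B, C) = {angle C A B, angle A B C, angle B C A}"

definition degrees :: "real \<Rightarrow> real" where
  "degrees x = x * pi / 180"

end

theory Submission
  imports Defs
begin

text \<open>
  A triangle in which one angle lies between 18 and 162 degrees has all its angles at most 162
  degrees, since the angles add up to 180 degrees. So it is enough to exhibit in each subtriangle
  one such moderate angle, and most subtriangles have an obvious one: each subtriangle with one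
  vertex of the reference triangle and two nodes on the adjacent edges contains the full angle of
  45 or 90 degrees there, and the rules often produce a segment parallel to an edge and so an angle
  that is bounded away from 0 and 180 degrees.

  To keep everything polynomial, 18 degrees is replaced by the slightly larger angle whose
  cotangent is 3 (about 18.43 degrees). With \<open>d\<close> the inner product of the two sides
  at a vertex and \<open>D\<close> twice the signed area of the triangle, which is the same at
  all three vertices, the cotangent of the angle is \<open>d / D\<close>. An angle is therefore
  moderate when \<open>\<bar>d\<bar> \<le> 3 * D\<close>, a pair of polynomial
  inequalities in the parameters. The constant 3 is the natural one: when two edges are cut and the
  free parameter is one half, the middle triangle can degenerate towards an angle of cotangent
  \<open>- 3\<close>, for instance at \<open>node_r r\<close> for \<open>q = 1/2\<close>
  when \<open>r\<close> tends to 0, \<open>s\<close> tends to 1 and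
  \<open>(1 - s) / r\<close> tends to 0.

  Interchanging the coordinates exchanges the nodes on the two legs, and with them the cut of the
  edges s, r and that of the edges q, r, and also the two kinds of cut through an acute vertex;
  only one cut of each such pair needs a computation.
\<close>

section \<open>Moderate angles\<close>

definition double_area :: "point \<Rightarrow> point \<Rightarrow> point \<Rightarrow> real" where
  "double_area A B C =
     (fst B - fst A) * (snd C - snd A) - (snd B - snd A) * (fst C - fst A)"

text \<open>
  The sign of the area is kept because the vertices of all the subtriangles are listed
  counterclockwise, so that no absolute value of an area is ever needed.
\<close>

definition moderate :: "point \<Rightarrow> point \<Rightarrow> point \<Rightarrow> bool" where
  "moderate A B C \<longleftrightarrow> \<bar>(A - B) \<bullet> (C - B)\<bar> \<le> 3 * double_area A B C"

fun has_moderate_angle :: "triangle \<Rightarrow> bool" where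
  "has_moderate_angle (A, B, C) \<longleftrightarrow> moderate C A B \<or> moderate A B C \<or> moderate B C A"

lemma double_area_rotate: "double_area B C A = double_area A B C"
  by (simp add: double_area_def algebra_simps)

text \<open>
  The equation \<open>cos 3x = - cos 2x\<close> at 36 degrees is a cubic for the cosine, and after
  division by the factor that belongs to 180 degrees the quadratic \<open>4c\<^sup>2 = 2c + 1\<close>
  remains. Its positive root is \<open>(1 + sqrt 5) / 4\<close>, about 0.809.
\<close>

lemma cos_36_degrees_ge: "cos (pi / 5) \<ge> 4 / 5"
proof (rule ccontr)
  let ?c = "cos (pi / 5)"
  assume less: "\<not> ?c \<ge> 4 / 5"
  have pos: "?c > 0"
    by (rule cos_gt_zero_pi) (use pi_gt_zero in linarith)+
  have "cos (3 * (pi / 5)) = cos (pi - 2 * (pi / 5))"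
    by (rule arg_cong[where f = cos]) simp
  also have "\<dots> = - cos (2 * (pi / 5))"
    by (rule cos_pi_minus)
  finally have "4 * ?c ^ 3 - 3 * ?c = - (2 * ?c\<^sup>2 - 1)"
    by (simp only: cos_treble_cos cos_double_cos)
  then have "(?c + 1) * (4 * ?c\<^sup>2 - 2 * ?c - 1) = 0"
    by (simp add: algebra_simps power2_eq_square power3_eq_cube)
  with pos have "4 * ?c\<^sup>2 - 2 * ?c - 1 = 0"
    by simp
  then have "?c * (4 * ?c - 2) = 1"
    by (simp add: algebra_simps power2_eq_square)
  moreover have "?c * (4 * ?c - 2) \<le> ?c * (6 / 5)"
    using less pos by (intro mult_left_mono) auto
  ultimately show False
    using less by simp
qed

text \<open>
  The right-hand side is the cosine of the angle with cotangent \<open>- 3\<close>; the inequality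
  says that this angle is slightly smaller than 162 degrees.
\<close>

lemma cos_162_degrees_le: "cos (degrees 162) \<le> - sqrt (9 / 10)"
proof -
  have "cos (pi / 5) = 2 * (cos (pi / 10))\<^sup>2 - 1"
    using cos_double_cos[of "pi / 10"] by simp
  then have "9 / 10 \<le> (cos (pi / 10))\<^sup>2"
    using cos_36_degrees_ge by simp
  moreover have "cos (pi / 10) \<ge> 0"
    by (rule cos_ge_zero) auto
  ultimately have "sqrt (9 / 10) \<le> cos (pi / 10)"
    by (rule real_le_lsqrt[rotated])
  moreover have "degrees 162 = pi - pi / 10"
    by (simp add: degrees_def)
  ultimately show ?thesis
    by (simp only: cos_pi_minus)
qed

text \<open>
  Inner product and area of a corner are proportional to the cosine and sine of its angle, so that
  \<open>(d\<^sup>2 + D\<^sup>2) = (norm (A - B) * norm (C - B))\<^sup>2\<close> (Lagrange's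
  identity), which turns a bound on the cotangent into one on the cosine.
\<close>

lemma angle_le_162_degrees:
  assumes "- 3 * double_area A B C \<le> (A - B) \<bullet> (C - B)"
  shows "angle A B C \<le> degrees 162"
proof -
  let ?d = "(A - B) \<bullet> (C - B)" and ?D = "double_area A B C"
  let ?n = "norm (A - B) * norm (C - B)"
  have lagrange: "?d\<^sup>2 + ?D\<^sup>2 = ?n\<^sup>2"
    by (simp add: power_mult_distrib power2_norm_eq_inner inner_prod_def double_area_def)
      (simp add: power2_eq_square algebra_simps)
  have n_nonneg: "?n \<ge> 0"
    by simp
  have "- ?d \<le> sqrt (9 / 10) * ?n"
  proof (cases "?d < 0")
    case True
    then have "(- ?d)\<^sup>2 \<le> (3 * ?D)\<^sup>2"
      using assms by (intro power_mono) auto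
    then have "?d\<^sup>2 \<le> (9 / 10) * ?n\<^sup>2"
      unfolding lagrange[symmetric] by (simp add: power_mult_distrib)
    then have "(- ?d)\<^sup>2 \<le> (sqrt (9 / 10) * ?n)\<^sup>2"
      by (simp add: power_mult_distrib)
    then show ?thesis
      by (rule power2_le_imp_le) simp
  next
    case False
    moreover have "sqrt (9 / 10) * ?n \<ge> 0"
      by simp
    ultimately show ?thesis
      by linarith
  qed
  then have "- sqrt (9 / 10) \<le> ?d / ?n"
    using n_nonneg by (cases "?n = 0") (auto simp: field_simps)
  then have "cos (degrees 162) \<le> ?d / ?n"
    using cos_162_degrees_le by linarith
  moreover have "?d / ?n \<le> 1"
    using norm_cauchy_schwarz[of "A - B" "C - B"] by (cases "?n = 0") (auto simp: divide_le_eq_1)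
  ultimately have "arccos (?d / ?n) \<le> arccos (cos (degrees 162))"
    by (intro arccos_le_arccos) auto
  also have "\<dots> = degrees 162"
    by (rule arccos_cos) (auto simp: degrees_def)
  finally show ?thesis
    by (simp add: angle_def)
qed

text \<open>
  The inner products at the two ends of a side add up to the square of its length. If the one at
  \<open>A\<close> were below \<open>- 3 * D\<close>, the one at \<open>B\<close> would therefore exceed
  \<open>3 * D\<close>. This is the argument with the sum of the angles in algebraic form.
\<close>

lemma moderate_bounds_angles:
  assumes "moderate A B C"
  shows "angle C A B \<le> degrees 162" "angle A B C \<le> degrees 162" "angle B C A \<le> degrees 162"
proof -
  let ?D = "double_area A B C" and ?d = "(A - B) \<bullet> (C - B)"
  have d: "?d \<le> 3 * ?D" "- 3 * ?D \<le> ?d"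
    using assms by (auto simp: moderate_def abs_le_iff)
  have "(C - A) \<bullet> (B - A) + ?d = (A - B) \<bullet> (A - B)"
    and "(B - C) \<bullet> (A - C) + ?d = (C - B) \<bullet> (C - B)"
    by (simp_all add: inner_diff_left inner_diff_right inner_commute)
  moreover have "(A - B) \<bullet> (A - B) \<ge> 0" "(C - B) \<bullet> (C - B) \<ge> 0"
    by (rule inner_ge_zero)+
  ultimately have "- 3 * ?D \<le> (C - A) \<bullet> (B - A)" "- 3 * ?D \<le> (B - C) \<bullet> (A - C)"
    using d by linarith+
  then show "angle C A B \<le> degrees 162" "angle A B C \<le> degrees 162" "angle B C A \<le> degrees 162"
    using d(2) by (auto intro!: angle_le_162_degrees simp: double_area_rotate)
qed

lemma has_moderate_angle_bounds_angles:
  assumes "has_moderate_angle T" and "\<phi> \<in> interior_angles T"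
  shows "\<phi> \<le> degrees 162"
  using assms by (cases T) (auto dest: moderate_bounds_angles)

text \<open>Reflection in the diagonal reverses the orientation, whence the order of the vertices.\<close>

lemma moderate_swap:
  "moderate A B C \<longleftrightarrow> moderate (prod.swap C) (prod.swap B) (prod.swap A)"
  by (simp add: moderate_def double_area_def inner_prod_def algebra_simps)

lemma swap_node [simp]:
  "prod.swap (node_s x) = node_q x"
  "prod.swap (node_q x) = node_s x"
  "prod.swap (node_r x) = node_r (1 - x)"
  by (simp_all add: node_s_def node_q_def node_r_def)


section \<open>Triangles at a vertex of the reference triangle\<close>

lemma moderate_corner_00:
  assumes "0 < s" "0 < q"
  shows "moderate (node_q q) (0, 0) (node_s s)"
  using assms by (simp add: moderate_def double_area_def node_s_def node_q_def)

lemma moderate_corner_10: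
  assumes "s < 1" "0 < r"
  shows "moderate (node_s s) (1, 0) (node_r r)"
proof -
  have "0 \<le> r * (1 - s)"
    using assms by simp
  then show ?thesis
    by (simp add: moderate_def double_area_def node_s_def node_r_def algebra_simps abs_le_iff)
qed

lemma moderate_corner_01:
  assumes "q < 1" "r < 1"
  shows "moderate (node_r r) (0, 1) (node_q q)"
  using moderate_swap[of "node_r r" "(0, 1)" "node_q q"] moderate_corner_10[of q "1 - r"] assms
  by simp


section \<open>The middle triangle for two cut edges\<close>

lemma moderate_at_node_s_iff:
  "moderate (node_q q) (node_s s) (node_r r) \<longleftrightarrow>
     \<bar>r * q - s * (1 - r - s)\<bar> \<le> 3 * ((1 - r - s) * q + r * s)"
  by (simp add: moderate_def double_area_def node_s_def node_q_def node_r_def algebra_simps)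

lemma moderate_at_node_q_iff:
  "moderate (node_r r) (node_q q) (node_s s) \<longleftrightarrow> moderate (node_q s) (node_s q) (node_r (1 - r))"
  using moderate_swap[of "node_r r" "node_q q" "node_s s"] by simp

text \<open>
  The next two lemmas are for the rules that place a node straight across from another one: the
  segment joining the nodes is then parallel to a leg.
\<close>

lemma moderate_at_node_s_vertical:
  assumes "1/2 < s" "s < 1" "0 < q" "q < 1"
  shows "moderate (node_q q) (node_s s) (node_r (1 - s))"
proof -
  have "(1 - s) * q \<le> (1 - s) * (3 * s)" "0 \<le> (1 - s) * q"
    using assms by (auto intro!: mult_left_mono)
  then show ?thesis
    unfolding moderate_at_node_s_iff by (simp add: algebra_simps)
qed

lemma moderate_at_node_q_horizontal:
  assumes "1/2 < q" "q < 1" "0 < s" "s < 1"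
  shows "moderate (node_r q) (node_q q) (node_s s)"
  using moderate_at_node_s_vertical[of q s] assms by (simp add: moderate_at_node_q_iff)

text \<open>
  A product puts the free node so close to a vertex, compared with the distances of the other nodes
  from the vertices, that the angle at the free node lies between 45 and 90 degrees:
  the inner product \<open>d\<close> and the area \<open>D\<close> below, from which a common
  factor has been taken out, satisfy \<open>0 \<le> d \<le> D\<close>.
\<close>

lemma moderate_at_node_r_product:
  assumes "1/2 < q" "q < 1" "1/2 < s" "s < 1"
  shows "moderate (node_s s) (node_r ((1 - s) * (1 - q))) (node_q q)"
proof -
  define a b where "a = 1 - s" and "b = 1 - q"
  have ab: "0 < a" "a < 1/2" "0 < b" "b < 1/2"
    using assms by (auto simp: a_def b_def)
  define d D where "d = (1 - b)\<^sup>2 - a * b * (1 - 2 * b)" and "D = 1 - b + b\<^sup>2 - a * b"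
  have "a * b \<le> (1/2) * (1/2)"
    using ab by (intro mult_mono) auto
  then have ab': "2 * (a * b) \<le> 1 / 2"
    by simp
  have "a * b * (1 - 2 * b) \<le> (1/4) * 1"
    using ab ab' by (intro mult_mono) auto
  moreover have "(1/2)\<^sup>2 \<le> (1 - b)\<^sup>2"
    using ab by (intro power_mono) auto
  ultimately have d: "0 \<le> d"
    by (simp add: d_def power2_eq_square)
  have "D - d = b * (1 - 2 * (a * b))"
    by (simp add: D_def d_def power2_eq_square algebra_simps)
  moreover have "\<dots> \<ge> 0"
    using ab ab' by simp
  ultimately have "d \<le> D"
    by linarith
  then have "a * d \<le> 3 * (a * D)" "0 \<le> a * d"
    using ab d mult_left_mono[of d "3 * D" a] by simp_all
  moreover have "s = 1 - a" "q = 1 - b"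
    by (simp_all add: a_def b_def)
  moreover have "(node_s (1 - a) - node_r (a * b)) \<bullet> (node_q (1 - b) - node_r (a * b)) = a * d"
    by (simp add: node_s_def node_q_def node_r_def d_def power2_eq_square algebra_simps)
  moreover have "double_area (node_s (1 - a)) (node_r (a * b)) (node_q (1 - b)) = a * D"
    by (simp add: double_area_def node_s_def node_q_def node_r_def D_def power2_eq_square
        algebra_simps)
  ultimately show ?thesis
    by (simp add: moderate_def)
qed

lemma moderate_at_node_q_product:
  assumes "0 < s" "s < 1/2" "1/2 < r" "r < 1"
  shows "moderate (node_r r) (node_q ((1 - r) * s)) (node_s s)"
proof -
  define t where "t = 1 - r"
  have t: "0 < t" "t < 1/2" and r: "r = 1 - t"
    using assms by (auto simp: t_def)
  define d D where "d = t\<^sup>2 * (1 + s)" and "D = 1 - t - s * t + t\<^sup>2"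
  have "s * t \<le> (1/2) * (1/2)"
    using assms t by (intro mult_mono) auto
  moreover have "t\<^sup>2 * s \<le> (1/2)\<^sup>2 * (1/2)"
    using assms t by (intro mult_mono power_mono) auto
  ultimately have "d \<le> D"
    using t by (simp add: d_def D_def power2_eq_square algebra_simps)
  moreover have "0 \<le> d"
    using assms by (simp add: d_def)
  ultimately have "s * d \<le> 3 * (s * D)" "0 \<le> s * d"
    using assms mult_left_mono[of d "3 * D" s] by simp_all
  moreover have "(node_r r - node_q (t * s)) \<bullet> (node_s s - node_q (t * s)) = s * d"
    by (simp add: node_s_def node_q_def node_r_def d_def r power2_eq_square algebra_simps)
  moreover have "double_area (node_r r) (node_q (t * s)) (node_s s) = s * D"
    by (simp add: double_area_def node_s_def node_q_def node_r_def D_def r power2_eq_square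
        algebra_simps)
  ultimately show ?thesis
    by (simp add: moderate_def t_def)
qed

lemma moderate_at_node_s_isosceles:
  assumes "0 < s" "s < 1/2" "1/2 < r" "r < 1"
  shows "moderate (node_q s) (node_s s) (node_r r)"
proof -
  have "s * (2 * r + s - 1) \<le> s * (3 * (1 - s))" "0 \<le> s * (2 * r + s - 1)"
    using assms by (auto intro!: mult_left_mono)
  then show ?thesis
    unfolding moderate_at_node_s_iff by (simp add: algebra_simps)
qed

text \<open>
  The polynomials in the next two lemmas have degree one in \<open>q\<close> and in
  \<open>r\<close>, respectively. Those without an obvious factorization are written as convex
  combinations of their values at two points, which are nonnegative polynomials in
  \<open>s\<close>.
\<close>

lemma moderate_at_node_s_half_r:
  assumes "0 < q" "q < 1" "0 < s" "s < 1" "q \<le> 1/2 \<or> s \<le> 1/2"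
  shows "moderate (node_q q) (node_s s) (node_r (1/2))"
proof -
  have at_0: "0 \<le> s * (2 - s)"
    using assms by simp
  have upper: "0 \<le> q - 3 * s * q + 2 * s - s\<^sup>2"
  proof (cases "q \<le> 1/2")
    case True
    have "0 \<le> (1 - 2 * q) * (s * (2 - s)) + 2 * q * ((1 - s) * (1/2 + s))"
      using True assms at_0 by (intro add_nonneg_nonneg mult_nonneg_nonneg) auto
    also have "\<dots> = q - 3 * s * q + 2 * s - s\<^sup>2"
      by (simp add: power2_eq_square field_simps)
    finally show ?thesis .
  next
    case False
    then have "s \<le> 1/2"
      using assms by simp
    then have "s * s \<le> (1/2) * (1/2)"
      using assms by (intro mult_mono) auto
    then have "0 \<le> 1 - s - s * s"
      using \<open>s \<le> 1/2\<close> by simp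
    then have "0 \<le> (1 - q) * (s * (2 - s)) + q * (1 - s - s * s)"
      using assms at_0 by (intro add_nonneg_nonneg mult_nonneg_nonneg) auto
    also have "\<dots> = q - 3 * s * q + 2 * s - s\<^sup>2"
      by (simp add: power2_eq_square algebra_simps)
    finally show ?thesis .
  qed
  have "0 \<le> (1 - q) * (s + s\<^sup>2) + q * (1 + (1 - s)\<^sup>2)"
    using assms by (intro add_nonneg_nonneg mult_nonneg_nonneg) auto
  also have "\<dots> = 2 * q - 3 * s * q + s + s\<^sup>2"
    by (simp add: power2_eq_square algebra_simps)
  finally show ?thesis
    using upper unfolding moderate_at_node_s_iff abs_le_iff
    by (simp add: power2_eq_square field_simps)
qed

lemma moderate_at_node_s_half_q:
  assumes "0 < r" "r < 1" "0 < s" "s < 1" "1/2 \<le> s \<or> r \<le> 1/2"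
  shows "moderate (node_q (1/2)) (node_s s) (node_r r)"
proof -
  define a where "a = 1 - s"
  have a: "0 < a" "a < 1" and s: "s = 1 - a"
    using assms by (auto simp: a_def)
  have upper: "0 \<le> a * (5/2 - a - 2 * r)"
    using assms by (intro mult_nonneg_nonneg) (auto simp: a_def)
  have "0 \<le> (1 - r) * (a * (1/2 + a)) + r * ((3/2 - a) * (2 - a))"
    using assms a by (intro add_nonneg_nonneg mult_nonneg_nonneg) auto
  also have "\<dots> = 3 * r + a / 2 + a\<^sup>2 - 4 * a * r"
    by (simp add: power2_eq_square field_simps)
  finally show ?thesis
    using upper unfolding moderate_at_node_s_iff abs_le_iff s
    by (simp add: power2_eq_square field_simps)
qed

lemma middle_triangle_edges_qs:
  assumes "0 < r" "r < 1" "0 < q" "q < 1" "0 < s" "s < 1"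
    and "chosen_by_rules Edges_QS r q s"
  shows "has_moderate_angle (node_s s, node_r r, node_q q)"
  using assms moderate_at_node_s_vertical[of s q] moderate_at_node_q_horizontal[of q s]
    moderate_at_node_r_product[of q s] moderate_at_node_s_half_r[of q s]
  by (auto simp del: eq_divide_eq_numeral1 split: if_splits)

lemma middle_triangle_edges_sr:
  assumes "0 < r" "r < 1" "0 < q" "q < 1" "0 < s" "s < 1"
    and "chosen_by_rules Edges_SR r q s"
  shows "has_moderate_angle (node_s s, node_r r, node_q q)"
  using assms moderate_at_node_s_isosceles[of s r] moderate_at_node_q_horizontal[of r s]
    moderate_at_node_q_product[of s r] moderate_at_node_s_half_q[of r s]
  by (auto simp del: eq_divide_eq_numeral1 split: if_splits)

lemma middle_triangle_edges_qr:
  assumes "0 < r" "r < 1" "0 < q" "q < 1" "0 < s" "s < 1"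
    and "chosen_by_rules Edges_QR r q s"
  shows "has_moderate_angle (node_s s, node_r r, node_q q)"
proof -
  have "chosen_by_rules Edges_SR (1 - r) s q"
    using assms(7) by (auto simp: mult.commute split: if_splits)
  then have "has_moderate_angle (node_s q, node_r (1 - r), node_q s)"
    using assms by (intro middle_triangle_edges_sr) auto
  then show ?thesis
    using moderate_swap[of "node_q q" "node_s s" "node_r r"]
      moderate_swap[of "node_s s" "node_r r" "node_q q"]
      moderate_swap[of "node_r r" "node_q q" "node_s s"]
    by auto
qed


section \<open>Triangles beside a segment through a vertex\<close>

text \<open>
  For the cut through the right angle, one of the two angles at the origin is at least 45 degrees.
  The other one may be small, and it is there that the rules put a node vertically below
  \<open>node_r r\<close> or horizontally to the left of it.
\<close>

lemma moderate_vertex_00_below: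
  assumes "0 < r" "r < 1" "s = (if r < 1/2 then 1 - r else 1/2)"
  shows "has_moderate_angle ((0, 0), node_s s, node_r r)"
proof (cases "r < 1/2")
  case True
  then have "moderate (0, 0) (node_s s) (node_r r)"
    using assms by (simp add: moderate_def double_area_def node_s_def node_r_def)
  then show ?thesis
    by simp
next
  case False
  then have "s = 1/2" "1/2 \<le> r"
    using assms by auto
  then have "moderate (node_r r) (0, 0) (node_s s)"
    using assms(2) by (simp add: moderate_def double_area_def node_s_def node_r_def algebra_simps
        del: eq_divide_eq_numeral1)
  then show ?thesis
    by simp
qed

lemma moderate_vertex_00_above:
  assumes "0 < r" "r < 1" "q = (if r > 1/2 then r else 1/2)"
  shows "has_moderate_angle ((0, 0), node_r r, node_q q)"
proof -
  have "has_moderate_angle ((0, 0), node_s q, node_r (1 - r))"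
    using assms by (intro moderate_vertex_00_below) auto
  then show ?thesis
    using moderate_swap[of "node_r r" "node_q q" "(0, 0)"]
      moderate_swap[of "node_q q" "(0, 0)" "node_r r"]
      moderate_swap[of "(0, 0)" "node_r r" "node_q q"]
    by auto
qed

text \<open>
  For the cut through (1,0), the angle at the free node lies between 90 and 135 degrees in both
  triangles.
\<close>

lemma moderate_vertex_10_below:
  assumes "0 < q" "q < 1" "s = (if q < 1/2 then q else 1/2)"
  shows "moderate (node_q q) (node_s s) (1, 0)"
proof -
  have "0 \<le> q * (1 - q)"
    using assms by simp
  then show ?thesis
    using assms(3)
    by (auto simp: moderate_def double_area_def node_s_def node_q_def abs_le_iff algebra_simps)
qed

lemma moderate_vertex_10_above:
  assumes "0 < q" "q < 1" "r = (if q > 1/2 then q else 1/2)"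
  shows "moderate (1, 0) (node_r r) (node_q q)"
proof -
  have "0 \<le> q * (1 - q)"
    using assms by simp
  then show ?thesis
    using assms
    by (auto simp: moderate_def double_area_def node_r_def node_q_def abs_le_iff algebra_simps)
qed

lemma moderate_vertex_01_left:
  assumes "0 < s" "s < 1" "q = (if s < 1/2 then s else 1/2)"
  shows "moderate (0, 1) (node_q q) (node_s s)"
  using moderate_swap[of "(0, 1)" "node_q q" "node_s s"] moderate_vertex_10_below[of s q] assms
  by simp

lemma moderate_vertex_01_right:
  assumes "0 < s" "s < 1" "r = (if s > 1/2 then 1 - s else 1/2)"
  shows "moderate (node_s s) (node_r r) (0, 1)"
  using moderate_swap[of "node_s s" "node_r r" "(0, 1)"] moderate_vertex_10_above[of s "1 - r"]
    assms
  by (simp split: if_splits)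


section \<open>The angle bound\<close>

lemma subtriangles_have_moderate_angle:
  assumes "0 < r" "r < 1" "0 < q" "q < 1" "0 < s" "s < 1"
    and "chosen_by_rules c r q s" and "T \<in> subtriangles (configuration_of c) r q s"
  shows "has_moderate_angle T"
proof -
  note corners = moderate_corner_00[of s q] moderate_corner_10[of s r] moderate_corner_01[of q r]
  show ?thesis
  proof (cases c)
    case Edges_QS
    then show ?thesis
      using assms corners middle_triangle_edges_qs[of r q s] by auto
  next
    case Edges_SR
    then show ?thesis
      using assms corners middle_triangle_edges_sr[of r q s] by auto
  next
    case Edges_QR
    then show ?thesis
      using assms corners middle_triangle_edges_qr[of r q s] by auto
  next
    case Vertex_00_Edge_R
    then show ?thesis
      using assms corners moderate_vertex_00_below[of r s] moderate_vertex_00_above[of r q] by auto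
  next
    case Vertex_10_Edge_Q
    then show ?thesis
      using assms corners moderate_vertex_10_below[of q s] moderate_vertex_10_above[of q r] by auto
  next
    case Vertex_01_Edge_S
    then show ?thesis
      using assms corners moderate_vertex_01_left[of s q] moderate_vertex_01_right[of s r] by auto
  qed
qed

theorem lemma1:
  fixes r q s :: real and c :: cut
  assumes "r \<in> {0<..<1}" and "q \<in> {0<..<1}" and "s \<in> {0<..<1}"
    and "chosen_by_rules c r q s"
  shows "\<forall>T \<in> subtriangles (configuration_of c) r q s.
           \<forall>\<phi> \<in> interior_angles T. \<phi> \<le> degrees 162"
  using assms subtriangles_have_moderate_angle has_moderate_angle_bounds_angles
  by (metis greaterThanLessThan_iff)

end
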